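(* Whenever all the series concerned are either convergent or terminating, $$\sum_{m,n=0}^\infty\frac{(p,m+n)(2-p,m+n)(-1)^n x^{m+n}}{(p,m)(2-p,n)}L_m^{(p-1)}(-y)\,L_n^{(1-p)}(y)=(1-4xy)^{-1/2}.$$
   Context: Here $p$ is a complex parameter and $x,y$ are complex variables. $(\alpha,n)=\alpha(\alpha+1)\cdots(\alpha+n-1)$ for $n\ge1$ and $(\alpha,0)=1$ (Pochhammer symbol). The Laguerre polynomial is $L_n^{(a)}(x)=\frac{(a+1,n)}{n!}\,{}_1F_1[-n;a+1;x]$, where ${}_1F_1[\alpha;\beta;z]=\sum_{k\ge0}\frac{(\alpha,k)}{(\beta,k)}\frac{z^k}{k!}$. *)

theory Defs
  imports "HOL-Analysis.Analysis"
begin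

definition hyp1F1 :: "complex \<Rightarrow> complex \<Rightarrow> complex \<Rightarrow> complex" where
  "hyp1F1 a b z = (\<Sum>k. pochhammer a k / pochhammer b k * (z ^ k / fact k))"

text \<open>Meaningful for \<open>a + 1\<close> not a nonpositive integer; the series then terminates.\<close>

definition laguerre :: "nat \<Rightarrow> complex \<Rightarrow> complex \<Rightarrow> complex" where
  "laguerre n a x = pochhammer (a + 1) n / fact n * hyp1F1 (- of_nat n) (a + 1) x"

text \<open>The double series is read in two ways: as an unconditional sum over all \<open>(m, n)\<close>, and as a
  series in powers of \<open>x\<close>, summed over the diagonals \<open>m + n = N\<close>. The terms grow factorially
  along each row, so for \<open>x \<noteq> 0\<close> only the second reading gives a convergent series. No denominator
  below vanishes for any \<open>m, n\<close> iff neither \<open>p\<close> nor \<open>2 - p\<close> is a nonpositive integer.\<close>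

definition laguerre_term :: "complex \<Rightarrow> complex \<Rightarrow> complex \<Rightarrow> nat \<Rightarrow> nat \<Rightarrow> complex" where
  "laguerre_term p x y m n =
     pochhammer p (m + n) * pochhammer (2 - p) (m + n) * (- 1) ^ n * x ^ (m + n)
       / (pochhammer p m * pochhammer (2 - p) n)
       * laguerre m (p - 1) (- y) * laguerre n (1 - p) y"

end

theory Submission
  imports Defs "HOL-Computational_Algebra.Formal_Power_Series"
begin

text \<open>The generating function of \<open>L\<^sub>m\<^sup>(\<^sup>a\<^sup>)(x) / (a + 1, m)\<close> is \<open>exp t\<close> times \<open>0F1[a + 1; - x t]\<close>.
  The two exponentials belonging to \<open>L(-y)\<close> and to the alternating \<open>L(y)\<close> cancel, so a diagonal of the
  double series is a coefficient of the product \<open>0F1[p; y t] 0F1[2 - p; y t]\<close>, which Vandermonde's identity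
  evaluates. This makes the diagonal sums the terms of the binomial series of
  \<open>(1 - 4 x y) powr (- 1 / 2)\<close>. Where that series converges on the boundary of its disc, its value comes
  from Abel's limit theorem; it diverges at \<open>4 x y = 1\<close> like the harmonic series or worse.\<close>

section \<open>Laguerre polynomials as convolutions\<close>

lemma pochhammer_nonzero:
  fixes a :: complex
  assumes "a \<notin> \<int>\<^sub>\<le>\<^sub>0"
  shows "pochhammer a n \<noteq> 0"
  using assms by (auto simp: pochhammer_eq_0_iff)

lemma pochhammer_neg_of_nat:
  assumes "k \<le> n"
  shows "pochhammer (- of_nat n) k = (- 1) ^ k * fact n / (fact (n - k) :: complex)"
proof -
  have "(of_nat n gchoose k :: complex) = fact n / (fact k * fact (n - k))"
    using assms by (metis binomial_fact binomial_gbinomial)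
  then have "(- 1) ^ k * pochhammer (- of_nat n) k = fact n / (fact (n - k) :: complex)"
    unfolding gbinomial_pochhammer by (simp add: field_simps)
  then have "(- 1) ^ k * ((- 1) ^ k * pochhammer (- of_nat n) k)
      = (- 1) ^ k * (fact n / (fact (n - k) :: complex))"
    by simp
  then show ?thesis
    by (simp add: mult.assoc[symmetric] flip: power_mult_distrib)
qed

text \<open>The prefactor of \<open>laguerre\<close> cancels and leaves a Cauchy product: the
  coefficients \<open>(- x) ^ k / (fact k * pochhammer (a + 1) k)\<close> of 0F1[a + 1; -x t]
  against the coefficients \<open>1 / fact (n - k)\<close> of exp t.\<close>

lemma laguerre_div_pochhammer:
  assumes "a + 1 \<notin> \<int>\<^sub>\<le>\<^sub>0"
  shows "laguerre n a x / pochhammer (a + 1) n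
      = (\<Sum>k\<le>n. (- x) ^ k / (fact k * pochhammer (a + 1) k * fact (n - k)))"
proof -
  have nz: "pochhammer (a + 1) k \<noteq> 0" for k
    using assms by (rule pochhammer_nonzero)
  have "hyp1F1 (- of_nat n) (a + 1) x
      = (\<Sum>k\<le>n. pochhammer (- of_nat n) k / pochhammer (a + 1) k * (x ^ k / fact k))"
    unfolding hyp1F1_def
    by (rule suminf_finite) (auto simp: pochhammer_of_nat_eq_0_iff)
  also have "\<dots> = (\<Sum>k\<le>n. fact n * ((- x) ^ k / (fact k * pochhammer (a + 1) k * fact (n - k))))"
    by (intro sum.cong refl) (simp add: pochhammer_neg_of_nat power_minus[of x] mult_ac)
  also have "\<dots> = fact n * (\<Sum>k\<le>n. (- x) ^ k / (fact k * pochhammer (a + 1) k * fact (n - k)))"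
    by (simp add: sum_distrib_left)
  finally show ?thesis
    by (simp add: laguerre_def nz)
qed

section \<open>Diagonal sums as binomial coefficients\<close>

text \<open>Multiplied by (a, N)(b, N), the summands become products of two binomial coefficients
  whose upper entries do not depend on k, so Vandermonde's identity applies. The sum is the
  coefficient of t^N in 0F1[a; t] 0F1[b; t].\<close>

lemma sum_inverse_pochhammer_convolution:
  fixes a b :: complex
  assumes "a \<notin> \<int>\<^sub>\<le>\<^sub>0" "b \<notin> \<int>\<^sub>\<le>\<^sub>0"
  shows "(\<Sum>k\<le>N. 1 / (fact k * pochhammer a k * (fact (N - k) * pochhammer b (N - k))))
      = pochhammer (a + b + of_nat N - 1) N / (fact N * pochhammer a N * pochhammer b N)"
proof -
  have nza: "pochhammer a k \<noteq> 0" and nzb: "pochhammer b k \<noteq> 0" for k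
    using assms by (simp_all add: pochhammer_nonzero)
  have summand: "1 / (fact k * pochhammer a k * (fact (N - k) * pochhammer b (N - k)))
      = ((b + of_nat N - 1) gchoose k) * ((a + of_nat N - 1) gchoose (N - k))
          / (pochhammer a N * pochhammer b N)" if "k \<le> N" for k
  proof -
    \<comment> \<open>The factors of (a, N) after the first k end at a + N - 1 whatever k is; hence
      the fixed upper entry.\<close>
    have a: "pochhammer a N = pochhammer a k * (fact (N - k) * ((a + of_nat N - 1) gchoose (N - k)))"
      using that pochhammer_product[OF that, of a]
      by (simp add: gbinomial_pochhammer' of_nat_diff algebra_simps)
    have b: "pochhammer b N = pochhammer b (N - k) * (fact k * ((b + of_nat N - 1) gchoose k))"
      using that pochhammer_product[of "N - k" N b]
      by (simp add: gbinomial_pochhammer' of_nat_diff algebra_simps)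
    \<comment> \<open>These are factors of the nonzero (a, N) and (b, N), so they may be
      cancelled.\<close>
    have "(a + of_nat N - 1) gchoose (N - k) \<noteq> 0" "(b + of_nat N - 1) gchoose k \<noteq> 0"
      using a b nza[of N] nzb[of N] by auto
    then show ?thesis
      by (subst a, subst b) (simp add: nza nzb)
  qed
  have "(\<Sum>k\<le>N. 1 / (fact k * pochhammer a k * (fact (N - k) * pochhammer b (N - k))))
      = (\<Sum>k\<le>N. ((b + of_nat N - 1) gchoose k) * ((a + of_nat N - 1) gchoose (N - k)))
          / (pochhammer a N * pochhammer b N)"
    by (simp add: summand sum_divide_distrib)
  also have "(\<Sum>k\<le>N. ((b + of_nat N - 1) gchoose k) * ((a + of_nat N - 1) gchoose (N - k)))
      = (b + of_nat N - 1 + (a + of_nat N - 1)) gchoose N"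
    unfolding atMost_atLeast0 by (rule gbinomial_Vandermonde)
  also have "\<dots> = pochhammer (a + b + of_nat N - 1) N / fact N"
    by (simp add: gbinomial_pochhammer' algebra_simps)
  finally show ?thesis
    by simp
qed

text \<open>Both sides are the central binomial coefficient (2N)!/(N!)^2; the duplication formula
  turns (2N)! into 4^N N! (1/2, N).\<close>

lemma pochhammer_Suc_of_nat_gbinomial:
  "pochhammer (of_nat N + 1) N / fact N = (- 4) ^ N * ((- 1 / 2 :: complex) gchoose N)"
proof -
  have "fact N * pochhammer (of_nat N + 1) N = (fact (2 * N) :: complex)"
    using pochhammer_product'[of "1 :: complex" N N]
    by (simp add: pochhammer_fact mult_2 add.commute)
  also have "\<dots> = fact N * (4 ^ N * pochhammer (1 / 2) N)"
    by (simp add: fact_double power_mult)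
  finally have "pochhammer (of_nat N + 1) N = (4 ^ N * pochhammer (1 / 2) N :: complex)"
    by simp
  then show ?thesis
    by (simp add: gbinomial_pochhammer flip: power_mult_distrib)
qed

text \<open>The parameters p and 2 - p add up to 2, so a + b + N - 1 in the convolution formula
  becomes N + 1, and its denominators cancel the factors (p, N)(2 - p, N): p drops out of every
  diagonal.\<close>

lemma laguerre_term_diagonal:
  assumes p: "p \<notin> \<int>\<^sub>\<le>\<^sub>0" "2 - p \<notin> \<int>\<^sub>\<le>\<^sub>0"
  shows "(\<Sum>m\<le>N. laguerre_term p x y m (N - m)) = ((- 1 / 2) gchoose N) * (- (4 * x * y)) ^ N"
proof -
  \<comment> \<open>With t the formal variable, \<open>U\<close> is 0F1[p; y t] and \<open>V\<close>
    is 0F1[2 - p; y t].\<close>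
  define U where "U = Abs_fps (\<lambda>k. y ^ k / (fact k * pochhammer p k))"
  define V where "V = Abs_fps (\<lambda>k. y ^ k / (fact k * pochhammer (2 - p) k))"
  have nz: "pochhammer p N \<noteq> 0" "pochhammer (2 - p) N \<noteq> 0"
    using p by (simp_all add: pochhammer_nonzero)
  have F: "laguerre m (p - 1) (- y) / pochhammer p m = fps_nth (U * fps_exp 1) m" for m
    using laguerre_div_pochhammer[of "p - 1" m "- y"] p
    by (simp add: U_def fps_mult_nth atMost_atLeast0)
  \<comment> \<open>The sign (-1)^n substitutes -t for t: exp t 0F1[2 - p; -y t] becomes exp (-t)
    0F1[2 - p; y t].\<close>
  have G: "(- 1) ^ n * laguerre n (1 - p) y / pochhammer (2 - p) n
      = fps_nth (V * fps_exp (- 1)) n" for n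
  proof -
    have "(- 1) ^ n * (laguerre n (1 - p) y / pochhammer (2 - p) n)
        = (\<Sum>k\<le>n. (- 1) ^ n * ((- y) ^ k / (fact k * pochhammer (2 - p) k * fact (n - k))))"
      using laguerre_div_pochhammer[of "1 - p" n y] p by (simp add: sum_distrib_left)
    also have "\<dots> = (\<Sum>k\<le>n. y ^ k / (fact k * pochhammer (2 - p) k) * ((- 1) ^ (n - k) / fact (n - k)))"
    proof (intro sum.cong refl)
      fix k assume "k \<in> {..n}"
      then have "n = (n - k) + k" by simp
      then have "(- 1) ^ n = (- 1) ^ (n - k) * (- 1 :: complex) ^ k"
        by (metis power_add)
      then have "(- 1) ^ n * (- y) ^ k = (- 1) ^ (n - k) * y ^ k"
        by (simp add: mult.assoc flip: power_mult_distrib)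
      then show "(- 1) ^ n * ((- y) ^ k / (fact k * pochhammer (2 - p) k * fact (n - k)))
          = y ^ k / (fact k * pochhammer (2 - p) k) * ((- 1) ^ (n - k) / fact (n - k))"
        by (simp add: mult_ac)
    qed
    finally show ?thesis
      by (simp add: V_def fps_mult_nth atMost_atLeast0)
  qed
  have UV: "(U * fps_exp 1) * (V * fps_exp (- 1)) = U * V"
    using fps_exp_add_mult[of 1 "- 1 :: complex"] by (simp add: mult_ac)
  have "(\<Sum>m\<le>N. laguerre_term p x y m (N - m))
      = pochhammer p N * pochhammer (2 - p) N * x ^ N *
        (\<Sum>m\<le>N. fps_nth (U * fps_exp 1) m * fps_nth (V * fps_exp (- 1)) (N - m))"
    unfolding F[symmetric] G[symmetric] sum_distrib_left
    by (intro sum.cong refl) (simp add: laguerre_term_def mult_ac)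
  also have "(\<Sum>m\<le>N. fps_nth (U * fps_exp 1) m * fps_nth (V * fps_exp (- 1)) (N - m))
      = fps_nth (U * V) N"
    unfolding UV[symmetric] atMost_atLeast0 by (rule fps_mult_nth[symmetric])
  also have "\<dots> = (\<Sum>k\<le>N. y ^ N *
      (1 / (fact k * pochhammer p k * (fact (N - k) * pochhammer (2 - p) (N - k)))))"
    unfolding fps_mult_nth atMost_atLeast0
    by (intro sum.cong refl) (simp add: U_def V_def flip: power_add)
  also have "\<dots> = y ^ N * (pochhammer (of_nat N + 1) N / (fact N * pochhammer p N * pochhammer (2 - p) N))"
    unfolding sum_distrib_left[symmetric]
    by (subst sum_inverse_pochhammer_convolution[OF p]) (simp add: add.commute)
  also have "pochhammer p N * pochhammer (2 - p) N * x ^ N * \<dots>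
      = x ^ N * y ^ N * (pochhammer (of_nat N + 1) N / fact N)"
    using nz by simp
  also have "\<dots> = ((- 1 / 2) gchoose N) * (- (4 * x * y)) ^ N"
    unfolding pochhammer_Suc_of_nat_gbinomial
    using power_mult_distrib[of "- 4" "x * y" N] by (simp add: power_mult_distrib mult_ac)
  finally show ?thesis .
qed

section \<open>Abel's limit theorem\<close>

text \<open>Summation by parts: the difference is \<open>(1 - r)\<close> times the power series of the remainders
  of the partial sums, and these tend to \<open>0\<close>.\<close>

theorem Abel_limit:
  fixes c :: "nat \<Rightarrow> complex"
  assumes "summable c"
  shows "((\<lambda>r. \<Sum>n. c n * of_real r ^ n) \<longlongrightarrow> suminf c) (at_left 1)"
proof -
  define e where "e n = (\<Sum>k\<le>n. c k) - suminf c" for n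
  have "e \<longlonglongrightarrow> 0"
    using summable_LIMSEQ'[OF assms] unfolding e_def by (simp add: LIM_zero)
  \<comment> \<open>Boundedness of the remainders makes the series of \<open>e n * r ^ n\<close>
    converge for 0 < r < 1.\<close>
  then obtain B where B: "\<And>n. norm (e n) \<le> B"
    using convergent_imp_Bseq[of e] unfolding Bseq_def convergent_def by blast
  \<comment> \<open>The first N remainders are estimated with r^n <= 1, the later ones by d times
    the geometric series, whose sum 1/(1 - r) is undone by the factor 1 - r.\<close>
  have bound: "norm ((\<Sum>n. c n * of_real r ^ n) - suminf c)
      \<le> (1 - r) * (\<Sum>n<N. norm (e n)) + d"
    if r: "0 < r" "r < 1" and N: "\<And>n. n \<ge> N \<Longrightarrow> norm (e n) \<le> d" for r d N
  proof -
    define z where "z = complex_of_real r"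
    have geo: "(\<lambda>n. r ^ n) sums (1 / (1 - r))"
      using r by (intro geometric_sums) auto
    have ne: "summable (\<lambda>n. norm (e n) * r ^ n)"
      by (rule summable_comparison_test'[of "\<lambda>n. B * r ^ n" 0])
        (use B r geo in \<open>auto intro!: summable_mult mult_right_mono simp: sums_iff\<close>)
    then have se: "summable (\<lambda>n. norm (e n * z ^ n))"
      using r by (simp add: z_def norm_mult norm_power)
    then have sez: "summable (\<lambda>n. e n * z ^ n)"
      by (rule summable_norm_cancel)
    have sc: "summable (\<lambda>n. c n * z ^ n)"
      by (rule powser_inside[of c 1]) (use assms r in \<open>auto simp: z_def\<close>)
    define E where "E = (\<Sum>n. e n * z ^ n)"
    have e_Suc: "(\<Sum>n. e (Suc n) * z ^ Suc n) = E - e 0"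
      using suminf_split_head[OF sez] by (simp add: E_def)
    have e_shift: "(\<Sum>n. e n * z ^ Suc n) = z * E"
      using suminf_mult[OF sez, of z] by (simp add: E_def mult_ac)
    have c_Suc: "(\<Sum>n. c (Suc n) * z ^ Suc n) = (\<Sum>n. c n * z ^ n) - c 0"
      using suminf_split_head[OF sc] by simp
    \<comment> \<open>Consecutive remainders differ by a term of \<open>c\<close> at positive
      indices only; the missing \<open>e 0 = c 0 - suminf c\<close> later supplies the subtracted
      limit.\<close>
    have diff: "(\<Sum>n. c (Suc n) * z ^ Suc n)
        = (\<Sum>n. e (Suc n) * z ^ Suc n) - (\<Sum>n. e n * z ^ Suc n)"
    proof (subst suminf_diff)
      show "summable (\<lambda>n. e (Suc n) * z ^ Suc n)"
        using sez by (subst summable_Suc_iff)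
      show "summable (\<lambda>n. e n * z ^ Suc n)"
        using summable_mult[OF sez, of z] by (simp add: mult_ac)
    qed (simp add: e_def algebra_simps)
    have "(\<Sum>n. c n * z ^ n) - suminf c = (\<Sum>n. c (Suc n) * z ^ Suc n) + e 0"
      unfolding c_Suc by (simp add: e_def)
    also have "\<dots> = (1 - z) * E"
      unfolding diff e_Suc e_shift by (simp add: left_diff_distrib)
    finally have "(\<Sum>n. c n * z ^ n) - suminf c = (1 - z) * E" .
    moreover have "norm (1 - z) = 1 - r"
    proof -
      have "1 - z = of_real (1 - r)" by (simp add: z_def)
      then show ?thesis using r by (simp only: norm_of_real)
    qed
    ultimately have "norm ((\<Sum>n. c n * z ^ n) - suminf c) = (1 - r) * norm E"
      by (simp add: norm_mult)
    moreover have "norm E \<le> (\<Sum>n<N. norm (e n)) + d / (1 - r)"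
    proof -
      have f: "(\<lambda>n. if n < N then norm (e n) else 0) sums (\<Sum>n<N. norm (e n))"
        using sums_If_finite[of "\<lambda>n. n < N" "\<lambda>n. norm (e n)"] by (simp add: lessThan_def)
      have fg: "(\<lambda>n. (if n < N then norm (e n) else 0) + d * r ^ n)
          sums ((\<Sum>n<N. norm (e n)) + d * (1 / (1 - r)))"
        using f geo by (intro sums_add sums_mult)
      have d: "0 \<le> d"
        using N[of N] norm_ge_zero order_trans by blast
      have "norm E \<le> (\<Sum>n. norm (e n * z ^ n))"
        unfolding E_def by (rule summable_norm[OF se])
      also have "\<dots> = (\<Sum>n. norm (e n) * r ^ n)"
        using r by (simp add: z_def norm_mult norm_power)
      also have "\<dots> \<le> (\<Sum>n. (if n < N then norm (e n) else 0) + d * r ^ n)"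
      proof (rule suminf_le[OF _ ne])
        fix n
        show "norm (e n) * r ^ n \<le> (if n < N then norm (e n) else 0) + d * r ^ n"
        proof (cases "n < N")
          case True
          have "norm (e n) * r ^ n \<le> norm (e n)"
            using r by (simp add: mult_left_le power_le_one)
          moreover have "0 \<le> d * r ^ n" using d r by simp
          ultimately show ?thesis using True by simp
        qed (use N[of n] r in \<open>simp add: mult_right_mono\<close>)
      qed (use fg in \<open>simp add: sums_iff\<close>)
      also have "\<dots> = (\<Sum>n<N. norm (e n)) + d / (1 - r)"
        using fg by (simp add: sums_iff)
      finally show ?thesis .
    qed
    ultimately have "norm ((\<Sum>n. c n * z ^ n) - suminf c)
        \<le> (1 - r) * ((\<Sum>n<N. norm (e n)) + d / (1 - r))"
      using r by (simp only: mult_left_mono diff_ge_0_iff_ge less_imp_le)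
    also have "\<dots> = (1 - r) * (\<Sum>n<N. norm (e n)) + d"
      using r by (simp add: distrib_left)
    finally show ?thesis
      by (simp add: z_def)
  qed
  show ?thesis
  proof (rule tendstoI)
    fix \<epsilon> :: real assume "\<epsilon> > 0"
    then have "eventually (\<lambda>n. norm (e n) < \<epsilon> / 2) sequentially"
      using \<open>e \<longlonglongrightarrow> 0\<close> unfolding tendsto_iff by (simp only: dist_norm diff_zero half_gt_zero)
    then obtain N where N: "\<And>n. n \<ge> N \<Longrightarrow> norm (e n) \<le> \<epsilon> / 2"
      unfolding eventually_sequentially by (meson less_imp_le)
    have "((\<lambda>r. (1 - r) * (\<Sum>n<N. norm (e n)) + \<epsilon> / 2)
        \<longlongrightarrow> (1 - 1) * (\<Sum>n<N. norm (e n)) + \<epsilon> / 2) (at_left 1)"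
      by (intro tendsto_intros)
    then have "eventually (\<lambda>r. (1 - r) * (\<Sum>n<N. norm (e n)) + \<epsilon> / 2 < \<epsilon>) (at_left 1)"
      by (rule order_tendstoD(2)) (use \<open>\<epsilon> > 0\<close> in simp)
    moreover have "eventually (\<lambda>r :: real. 0 < r \<and> r < 1) (at_left 1)"
      using eventually_at_left_real[of 0 1] by simp
    ultimately show "eventually (\<lambda>r. dist (\<Sum>n. c n * of_real r ^ n) (suminf c) < \<epsilon>) (at_left 1)"
    proof eventually_elim
      case (elim r)
      then show ?case
        using bound[of r N "\<epsilon> / 2"] N by (auto simp: dist_norm)
    qed
  qed
qed

section \<open>The binomial series with exponent -1/2, wherever it converges\<close>

text \<open>The next coefficient gains a factor of modulus (n + 3/2)/(n + 2), while the bound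
  shrinks by the smaller (n + 1)/(n + 2). The bound is crude, but its series already
  diverges.\<close>

lemma norm_gbinomial_minus_half_ge:
  "1 / (2 * real (Suc n)) \<le> norm ((- 1 / 2 :: complex) gchoose Suc n)"
proof (induction n)
  case 0
  show ?case by simp
next
  case (Suc n)
  have "((- 1 / 2 :: complex) gchoose Suc (Suc n))
      = ((- 1 / 2) gchoose Suc n) * of_real (- (real n + 3 / 2) / (real n + 2))"
  proof -
    have "of_real (real n + 2) * ((- 1 / 2 :: complex) gchoose Suc (Suc n))
        = ((- 1 / 2) gchoose Suc n) * of_real (- (real n + 3 / 2))"
      using gbinomial_mult_1[of "- 1 / 2 :: complex" "Suc n"]
      by (simp add: field_simps) (simp add: eq_neg_iff_add_eq_0 add_ac)
    moreover have "complex_of_real (real n + 2) \<noteq> 0"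
      by (simp only: of_real_eq_0_iff)
    ultimately show ?thesis
      by (simp only: of_real_divide eq_divide_eq times_divide_eq_right mult.commute if_False not_False_eq_True if_True)
  qed
  then have "norm ((- 1 / 2 :: complex) gchoose Suc (Suc n))
      = norm ((- 1 / 2 :: complex) gchoose Suc n) * ((real n + 3 / 2) / (real n + 2))"
    by (simp only: norm_mult norm_of_real) simp
  also have "\<dots> \<ge> 1 / (2 * real (Suc n)) * ((real n + 3 / 2) / (real n + 2))"
    by (intro mult_right_mono Suc) simp
  finally show ?case
    by (rule order_trans[rotated]) (simp add: divide_simps, simp add: algebra_simps)
qed

lemma not_summable_norm_gbinomial_minus_half:
  "\<not> summable (\<lambda>n. norm ((- 1 / 2 :: complex) gchoose n))"
proof
  assume "summable (\<lambda>n. norm ((- 1 / 2 :: complex) gchoose n))"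
  then have "summable (\<lambda>n. norm ((- 1 / 2 :: complex) gchoose Suc n))"
    by (subst summable_Suc_iff)
  then have "summable (\<lambda>n. 1 / (2 * real (Suc n)))"
    by (rule summable_comparison_test'[of _ 0]) (use norm_gbinomial_minus_half_ge in simp)
  then have "summable (\<lambda>n. 2 * (1 / (2 * real (Suc n))))"
    by (rule summable_mult)
  moreover have "2 * (1 / (2 * real (Suc n))) = inverse (real (Suc n))" for n
    by (simp add: inverse_eq_divide del: of_nat_Suc)
  ultimately have "summable (\<lambda>n. inverse (real (Suc n)))"
    by simp
  then show False
    using not_summable_harmonic[where 'a = real] by (subst (asm) summable_Suc_iff) simp
qed

text \<open>Convergence forces |w| <= 1 and w distinct from 1, so 1 - w avoids the branch cut. Both
  sides are then limits of the same function at r w as r tends to 1 from below: the series by Abel's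
  theorem, the power by continuity.\<close>

lemma suminf_gbinomial_minus_half:
  fixes w :: complex
  assumes sm: "summable (\<lambda>n. ((- 1 / 2) gchoose n) * (- w) ^ n)"
  shows "(\<Sum>n. ((- 1 / 2) gchoose n) * (- w) ^ n) = (1 - w) powr (- 1 / 2)"
proof -
  have "norm w \<le> 1"
  proof (rule ccontr)
    assume "\<not> norm w \<le> 1"
    \<comment> \<open>Convergence at a point of modulus above 1 would give absolute convergence at
      1.\<close>
    then have "summable (\<lambda>n. norm (((- 1 / 2 :: complex) gchoose n) * 1 ^ n))"
      by (intro powser_insidea[OF sm]) auto
    then show False
      using not_summable_norm_gbinomial_minus_half by simp
  qed
  moreover have "w \<noteq> 1"
  proof
    assume "w = 1"
    \<comment> \<open>At w = 1 every term is the nonnegative number (1/2, n)/n!, so convergence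
      would be absolute.\<close>
    have "((- 1 / 2) gchoose n) * (- w) ^ n = of_real (norm ((- 1 / 2 :: complex) gchoose n))" for n
    proof -
      have "((- 1 / 2) gchoose n) * (- w) ^ n = (pochhammer (1 / 2) n / fact n :: complex)"
        using \<open>w = 1\<close> by (simp add: gbinomial_pochhammer flip: power_mult_distrib)
      also have "\<dots> = of_real (pochhammer (1 / 2) n / fact n)"
        by (simp flip: pochhammer_of_real)
      finally have *: "((- 1 / 2) gchoose n) * (- w) ^ n = of_real (pochhammer (1 / 2) n / fact n)" .
      have "0 \<le> (pochhammer (1 / 2) n / fact n :: real)"
        by (simp add: pochhammer_nonneg)
      then have "norm (((- 1 / 2) gchoose n) * (- w) ^ n) = pochhammer (1 / 2) n / fact n"
        unfolding * by (simp only: norm_of_real abs_of_nonneg)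
      then show ?thesis
        using * \<open>w = 1\<close> by (simp add: norm_mult norm_power)
    qed
    then show False
      using sm not_summable_norm_gbinomial_minus_half by (simp only: summable_of_real_iff)
  qed
  \<comment> \<open>In the closed unit disc only w = 1 has real part at least 1.\<close>
  ultimately have w: "Re w < 1"
    by (smt (verit) complex_Re_le_cmod complex_eq_iff cmod_power2 one_complex.sel zero_eq_power2
        power2_less_eq_zero_iff one_power2 power_mono norm_ge_zero zero_le_power2)
  have nz: "1 - w \<notin> \<real>\<^sub>\<le>\<^sub>0"
    using w by (auto simp: complex_nonpos_Reals_iff)
  have "((\<lambda>r. \<Sum>n. ((- 1 / 2) gchoose n) * (- w) ^ n * of_real r ^ n)
      \<longlongrightarrow> (\<Sum>n. ((- 1 / 2) gchoose n) * (- w) ^ n)) (at_left 1)"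
    by (rule Abel_limit[OF sm])
  \<comment> \<open>For 0 < r < 1 the point r w lies in the open disc, where the binomial theorem
    holds.\<close>
  moreover have "eventually (\<lambda>r. (\<Sum>n. ((- 1 / 2) gchoose n) * (- w) ^ n * of_real r ^ n)
      = (1 - w * of_real r) powr (- 1 / 2)) (at_left 1)"
  proof -
    have "eventually (\<lambda>r :: real. r \<in> {0<..<1}) (at_left 1)"
      by (rule eventually_at_left_real) simp
    then show ?thesis
    proof eventually_elim
      case (elim r)
      have "norm (- w * of_real r) \<le> 1 * norm (complex_of_real r)"
        unfolding norm_mult norm_minus_cancel using \<open>norm w \<le> 1\<close> by (intro mult_right_mono) auto
      also have "\<dots> < 1"
        using elim by simp
      finally have "(\<lambda>n. ((- 1 / 2) gchoose n) * (- w * of_real r) ^ n) sums (1 + - w * of_real r) powr (- 1 / 2)"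
        by (rule gen_binomial_complex)
      then show ?case
        by (simp only: power_mult_distrib sums_iff mult.assoc) simp
    qed
  qed
  ultimately have "((\<lambda>r. (1 - w * of_real r) powr (- 1 / 2))
      \<longlongrightarrow> (\<Sum>n. ((- 1 / 2) gchoose n) * (- w) ^ n)) (at_left 1)"
    by (rule Lim_transform_eventually)
  moreover have "((\<lambda>r. (1 - w * of_real r) powr (- 1 / 2))
      \<longlongrightarrow> (1 - w * of_real 1) powr (- 1 / 2)) (at_left 1)"
    using nz by (intro tendsto_intros) auto
  ultimately show ?thesis
    using tendsto_unique[OF trivial_limit_at_left_real] by fastforce
qed

section \<open>From the double series to its diagonals\<close>

text \<open>The map (m, n) -> (m + n, m) splits the index set into finite diagonals, and an
  unconditional sum may be evaluated piece by piece.\<close>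

lemma has_sum_diagonals_sums:
  fixes f :: "nat \<Rightarrow> nat \<Rightarrow> complex"
  assumes "((\<lambda>(m, n). f m n) has_sum S) UNIV"
  shows "(\<lambda>N. \<Sum>m\<le>N. f m (N - m)) sums S"
proof -
  have "((\<lambda>(N, m). f m (N - m)) has_sum S) (SIGMA N:UNIV. {..N})
      \<longleftrightarrow> ((\<lambda>(m, n). f m n) has_sum S) UNIV"
    by (rule has_sum_reindex_bij_witness[of _ "\<lambda>(m, n). (m + n, m)" "\<lambda>(N, m). (m, N - m)"]) auto
  then have "((\<lambda>(N, m). f m (N - m)) has_sum S) (SIGMA N:UNIV. {..N})"
    using assms by simp
  then have "((\<lambda>N. \<Sum>m\<le>N. f m (N - m)) has_sum S) UNIV"
    by (rule has_sum_Sigma') (simp add: has_sum_finite)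
  then show ?thesis
    by (rule has_sum_imp_sums)
qed

theorem mainTheorem5:
  fixes p x y :: complex
  assumes "p \<notin> \<int>\<^sub>\<le>\<^sub>0" and "2 - p \<notin> \<int>\<^sub>\<le>\<^sub>0"
  shows "((\<lambda>(m, n). laguerre_term p x y m n) summable_on UNIV \<longrightarrow>
            (\<Sum>\<^sub>\<infinity>(m, n). laguerre_term p x y m n) = (1 - 4 * x * y) powr (- 1 / 2))
       \<and> (summable (\<lambda>N. \<Sum>m\<le>N. laguerre_term p x y m (N - m)) \<longrightarrow>
            (\<Sum>N. \<Sum>m\<le>N. laguerre_term p x y m (N - m)) = (1 - 4 * x * y) powr (- 1 / 2))"
proof -
  have diag: "(\<Sum>N. \<Sum>m\<le>N. laguerre_term p x y m (N - m)) = (1 - 4 * x * y) powr (- 1 / 2)"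
    if "summable (\<lambda>N. \<Sum>m\<le>N. laguerre_term p x y m (N - m))"
    using that suminf_gbinomial_minus_half[of "4 * x * y"]
    unfolding laguerre_term_diagonal[OF assms] by blast
  \<comment> \<open>Unconditional summability yields convergence along the diagonals to the same
    value, so the second reading settles the first.\<close>
  moreover have "(\<Sum>\<^sub>\<infinity>(m, n). laguerre_term p x y m n) = (1 - 4 * x * y) powr (- 1 / 2)"
    if "(\<lambda>(m, n). laguerre_term p x y m n) summable_on UNIV"
    using has_sum_diagonals_sums[OF has_sum_infsum[OF that]] diag by (simp add: sums_iff)
  ultimately show ?thesis
    by blast
qed

end
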